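(* Let $K$ be an algebraically closed field of characteristic zero, let $K[x]=K[x_1,\ldots,x_n]$, let $A\in \operatorname{M}_n(K)$, and let $\phi$ be the $K$-algebra endomorphism of $K[x]$ given by $\phi(x)=Ax$. Let $\delta=I-\phi$, and let $\lambda_{11},\ldots,\lambda_{nn}$ be the eigenvalues of $A$ (listed with multiplicity). If $\lambda_{kk}^{i_k}\cdots\lambda_{nn}^{i_n}\neq 1$ for all $1\leq k\leq n$ and all $i_k,\ldots,i_n\in\mathbb{N}$ with $i_k+\cdots+i_n\geq 1$, then $\operatorname{Im}\delta$ is an ideal of $K[x]$. In particular, if $\lambda_{11}=\cdots=\lambda_{nn}=:\lambda$ and $\lambda$ is not a root of unity, then $\operatorname{Im}\delta$ is an ideal of $K[x]$.
   Context: $\mathbb{N}$ includes $0$. $I$ is the identity map, and $\operatorname{Im}\delta=\delta(K[x])$. "$\phi(x)=Ax$" means that $(\phi(x_1),\ldots,\phi(x_n))^t=A(x_1,\ldots,x_n)^t$. A map of the form $\delta=I-\phi$ with $\phi$ a $K$-algebra endomorphism is called an $\mathcal{E}$-derivation of $K[x]$. *)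

theory Defs
  imports
    "HOL-Library.Poly_Mapping"
    "HOL-Algebra.Ideal"
    "HOL-Algebra.RingHom"
    "Jordan_Normal_Form.Char_Poly"
begin

(* An exponent vector is a finitely supported function from variable indices to nat. *)
type_synonym 'k mpoly = "(nat \<Rightarrow>\<^sub>0 nat) \<Rightarrow>\<^sub>0 'k"

definition mconst :: "'k::comm_ring_1 \<Rightarrow> 'k mpoly" where
  "mconst c = Poly_Mapping.single 0 c"

definition mvar :: "nat \<Rightarrow> 'k::comm_ring_1 mpoly" where
  "mvar i = Poly_Mapping.single (Poly_Mapping.single i 1) 1"

(* K[x_1, ..., x_n]; the variable x_(i+1) is mvar i for i < n, in line with the
   0-based entries of matrices in Jordan_Normal_Form. *)
definition mpoly_ring :: "nat \<Rightarrow> 'k::comm_ring_1 mpoly ring" where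
  "mpoly_ring n =
     \<lparr>carrier = {p. \<forall>m \<in> Poly_Mapping.keys p. Poly_Mapping.keys m \<subseteq> {..<n}},
      monoid.mult = (*), one = 1, ring.zero = 0, add = (+)\<rparr>"

definition algebra_endo :: "nat \<Rightarrow> ('k::comm_ring_1 mpoly \<Rightarrow> 'k mpoly) \<Rightarrow> bool" where
  "algebra_endo n \<phi> \<longleftrightarrow>
     \<phi> \<in> Ring.ring_hom (mpoly_ring n) (mpoly_ring n) \<and> (\<forall>c. \<phi> (mconst c) = mconst c)"

(* phi(x) = A x *)
definition linear_on_vars ::
  "nat \<Rightarrow> 'k::comm_ring_1 mat \<Rightarrow> ('k mpoly \<Rightarrow> 'k mpoly) \<Rightarrow> bool" where
  "linear_on_vars n A \<phi> \<longleftrightarrow>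
     (\<forall>i<n. \<phi> (mvar i) = (\<Sum>j<n. mconst (A $$ (i, j)) * mvar j))"

(* Im(I - phi) *)
definition Im_E_derivation ::
  "nat \<Rightarrow> ('k::comm_ring_1 mpoly \<Rightarrow> 'k mpoly) \<Rightarrow> 'k mpoly set" where
  "Im_E_derivation n \<phi> = (\<lambda>p. p - \<phi> p) ` carrier (mpoly_ring n)"

(* The eigenvalues of A listed with multiplicity: lam 0, ..., lam (n-1) are the roots,
   with multiplicity, of the characteristic polynomial. *)
definition eigenvalue_list :: "nat \<Rightarrow> 'k::comm_ring_1 mat \<Rightarrow> (nat \<Rightarrow> 'k) \<Rightarrow> bool" where
  "eigenvalue_list n A lam \<longleftrightarrow> char_poly A = (\<Prod>k<n. [:- lam k, 1:])"

definition root_of_unity :: "'k::monoid_mult \<Rightarrow> bool" where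
  "root_of_unity z \<longleftrightarrow> (\<exists>m\<ge>1. z ^ m = 1)"


lemma mpoly_ring_simps:
  "carrier (mpoly_ring n) = {p. \<forall>m \<in> Poly_Mapping.keys p. Poly_Mapping.keys m \<subseteq> {..<n}}"
  "x \<otimes>\<^bsub>mpoly_ring n\<^esub> y = x * y" "\<one>\<^bsub>mpoly_ring n\<^esub> = 1"
  "\<zero>\<^bsub>mpoly_ring n\<^esub> = 0" "x \<oplus>\<^bsub>mpoly_ring n\<^esub> y = x + y"
  by (simp_all add: mpoly_ring_def)

lemma mpoly_carrier_add:
  "p \<in> carrier (mpoly_ring n) \<Longrightarrow> q \<in> carrier (mpoly_ring n) \<Longrightarrow>
   p + q \<in> carrier (mpoly_ring n)"
  using Poly_Mapping.keys_add[of p q] by (fastforce simp: mpoly_ring_simps)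

lemma mpoly_carrier_mult:
  "p \<in> carrier (mpoly_ring n) \<Longrightarrow> q \<in> carrier (mpoly_ring n) \<Longrightarrow>
   p * q \<in> carrier (mpoly_ring n)"
proof -
  assume p: "p \<in> carrier (mpoly_ring n)" and q: "q \<in> carrier (mpoly_ring n)"
  show ?thesis
    unfolding mpoly_ring_simps
  proof (intro CollectI ballI)
    fix m assume "m \<in> Poly_Mapping.keys (p * q)"
    then obtain a b where ab: "m = a + b" "a \<in> Poly_Mapping.keys p" "b \<in> Poly_Mapping.keys q"
      using keys_mult[of p q] by auto
    have "Poly_Mapping.keys a \<subseteq> {..<n}" "Poly_Mapping.keys b \<subseteq> {..<n}"
      using ab p q by (auto simp: mpoly_ring_simps)
    then show "Poly_Mapping.keys m \<subseteq> {..<n}"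
      using Poly_Mapping.keys_add[of a b] ab(1) by blast
  qed
qed

lemma mpoly_carrier_const: "mconst c \<in> carrier (mpoly_ring n)"
  by (auto simp: mpoly_ring_simps mconst_def)

lemma mpoly_carrier_0: "0 \<in> carrier (mpoly_ring n)"
  by (auto simp: mpoly_ring_simps)

lemma mpoly_carrier_1: "1 \<in> carrier (mpoly_ring n)"
  by (auto simp: mpoly_ring_simps)

lemma mpoly_carrier_var: "i < n \<Longrightarrow> mvar i \<in> carrier (mpoly_ring n)"
  by (auto simp: mpoly_ring_simps mvar_def)

lemma mpoly_carrier_uminus:
  "p \<in> carrier (mpoly_ring n) \<Longrightarrow> - p \<in> carrier (mpoly_ring n)"
  by (auto simp: mpoly_ring_simps)

lemma mpoly_carrier_sum:
  "(\<And>i. i \<in> S \<Longrightarrow> f i \<in> carrier (mpoly_ring n)) \<Longrightarrow> sum f S \<in> carrier (mpoly_ring n)"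
  by (induction S rule: infinite_finite_induct) (auto simp: mpoly_carrier_0 mpoly_carrier_add)

lemma mpoly_carrier_power:
  "p \<in> carrier (mpoly_ring n) \<Longrightarrow> p ^ k \<in> carrier (mpoly_ring n)"
  by (induction k) (auto simp: mpoly_carrier_1 mpoly_carrier_mult)

lemma mpoly_carrier_prod:
  "(\<And>i. i \<in> S \<Longrightarrow> f i \<in> carrier (mpoly_ring n)) \<Longrightarrow> prod f S \<in> carrier (mpoly_ring n)"
  by (induction S rule: infinite_finite_induct) (auto simp: mpoly_carrier_1 mpoly_carrier_mult)

lemma mpoly_ring_cring: "cring (mpoly_ring n :: 'k::comm_ring_1 mpoly ring)"
proof (rule cringI)
  show "abelian_group (mpoly_ring n :: 'k mpoly ring)"
  proof (rule abelian_groupI, simp_all only: mpoly_ring_simps(2-))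
    fix x :: "'k mpoly" assume "x \<in> carrier (mpoly_ring n)"
    then show "\<exists>y\<in>carrier (mpoly_ring n). y + x = 0"
      by (intro bexI[of _ "- x"]) (simp_all add: mpoly_carrier_uminus)
  qed (simp_all add: mpoly_carrier_add mpoly_carrier_0 add.assoc add.commute)
  show "comm_monoid (mpoly_ring n :: 'k mpoly ring)"
    by (rule comm_monoidI, simp_all only: mpoly_ring_simps(2-))
       (simp_all add: mpoly_carrier_mult mpoly_carrier_1 mult.assoc mult.commute)
qed (simp_all only: mpoly_ring_simps(2-) distrib_right)

(* Every matrix determines an endomorphism with phi(x) = A x. *)
lemma linear_endo_exists:
  fixes A :: "'k::comm_ring_1 mat"
  shows "\<exists>\<phi>. algebra_endo n \<phi> \<and> linear_on_vars n A \<phi>"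
proof -
  define L where "L i = (\<Sum>j<n. mconst (A $$ (i, j)) * mvar j)" for i
  define mon where "mon m = (\<Prod>i<n. L i ^ Poly_Mapping.lookup m i)" for m
  define \<phi> where
    "\<phi> p = (\<Sum>m\<in>Poly_Mapping.keys p. mconst (Poly_Mapping.lookup p m) * mon m)" for p
  have c0: "mconst (0::'k) = 0" by (simp add: mconst_def)
  have cadd: "mconst (a + b) = mconst a + mconst b" for a b :: 'k
    by (simp add: mconst_def single_add)
  have cmul: "mconst (a * b) = mconst a * mconst b" for a b :: 'k
    by (simp add: mconst_def mult_single)
  have mon_add: "mon (a + b) = mon a * mon b" for a b
    by (simp add: mon_def lookup_add power_add prod.distrib)
  have sup: "\<phi> p = (\<Sum>m\<in>S. mconst (Poly_Mapping.lookup p m) * mon m)"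
    if "finite S" "Poly_Mapping.keys p \<subseteq> S" for p S
    unfolding \<phi>_def
    by (rule sum.mono_neutral_left) (use that in \<open>auto simp: c0 in_keys_iff\<close>)
  have add: "\<phi> (p + q) = \<phi> p + \<phi> q" for p q
  proof -
    let ?S = "Poly_Mapping.keys p \<union> Poly_Mapping.keys q"
    have "\<phi> (p + q) = (\<Sum>m\<in>?S. mconst (Poly_Mapping.lookup (p + q) m) * mon m)"
      by (rule sup) (simp_all add: Poly_Mapping.keys_add)
    also have "\<dots> = \<phi> p + \<phi> q"
      by (subst (1 2) sup[of ?S])
         (auto simp: lookup_add cadd distrib_right sum.distrib)
    finally show ?thesis .
  qed
  have sing: "\<phi> (Poly_Mapping.single m c) = mconst c * mon m" for m c
    by (subst sup[of "{m}"]) auto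
  have zero: "\<phi> 0 = 0" by (simp add: \<phi>_def)
  have sumphi: "\<phi> (sum f S) = (\<Sum>i\<in>S. \<phi> (f i))" for f :: "(nat \<Rightarrow>\<^sub>0 nat) \<Rightarrow> _" and S
    by (induction S rule: infinite_finite_induct) (auto simp: zero add)
  have dec: "p = (\<Sum>m\<in>Poly_Mapping.keys p. Poly_Mapping.single m (Poly_Mapping.lookup p m))"
    for p :: "'k mpoly"
    by (rule poly_mapping_eqI)
       (auto simp: lookup_sum lookup_single when_def in_keys_iff)
  have mult: "\<phi> (p * q) = \<phi> p * \<phi> q" for p q
  proof -
    have "p * q = (\<Sum>a\<in>Poly_Mapping.keys p. \<Sum>b\<in>Poly_Mapping.keys q.
        Poly_Mapping.single (a + b) (Poly_Mapping.lookup p a * Poly_Mapping.lookup q b))"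
      by (subst dec[of p], subst dec[of q]) (simp add: sum_product mult_single)
    then have "\<phi> (p * q) = (\<Sum>a\<in>Poly_Mapping.keys p. \<Sum>b\<in>Poly_Mapping.keys q.
        mconst (Poly_Mapping.lookup p a * Poly_Mapping.lookup q b) * mon (a + b))"
      by (simp add: sumphi sing)
    also have "\<dots> = \<phi> p * \<phi> q"
      by (simp add: \<phi>_def sum_product cmul mon_add mult_ac)
    finally show ?thesis .
  qed
  have const: "\<phi> (mconst c) = mconst c" for c
    unfolding mconst_def[of c] sing by (simp add: mon_def mconst_def)
  have one: "\<phi> 1 = 1"
    using const[of 1] by (simp add: mconst_def)
  have var: "\<phi> (mvar i) = L i" if "i < n" for i
  proof -
    have "mon (Poly_Mapping.single i 1) = (\<Prod>j<n. if j = i then L i else 1)"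
      unfolding mon_def by (rule prod.cong) (auto simp: lookup_single when_def)
    also have "\<dots> = L i" using that by simp
    finally show ?thesis unfolding mvar_def sing by (simp add: mconst_def)
  qed
  have closed: "\<phi> p \<in> carrier (mpoly_ring n)" for p
    unfolding \<phi>_def mon_def L_def
    by (intro mpoly_carrier_sum mpoly_carrier_mult mpoly_carrier_const mpoly_carrier_prod
          mpoly_carrier_power mpoly_carrier_var) auto
  have "algebra_endo n \<phi>"
    unfolding algebra_endo_def
    by (auto intro!: Ring.ring_hom_memI simp: closed const simp: mpoly_ring_simps(2-) add mult one)
  moreover have "linear_on_vars n A \<phi>"
    by (simp add: linear_on_vars_def var L_def)
  ultimately show ?thesis by blast
qed

end

theory Submission
  imports Defs
begin

text \<open>
  Call a list of eigenvalues nonresonant if no monomial of positive degree in them equals 1.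
  Since \<open>\<phi>\<close> maps variables to linear forms, it preserves degrees, and on the forms of degree
  \<open>d\<close> it is the \<open>d\<close>-th symmetric power of a linear map with the eigenvalues
  \<open>lam 0, \<dots>, lam (n - 1)\<close>. Its eigenvalues there are the monomials of degree \<open>d\<close> in the
  \<open>lam j\<close>; nonresonance says that none of them is 1 for \<open>d \<ge> 1\<close>, so that \<open>I - \<phi>\<close> is onto in
  every positive degree, while it vanishes on constants. Hence its image consists of
  the polynomials without constant term, which form an ideal.

  Surjectivity is proved from a triangular form of \<open>\<phi>\<close> on linear forms. By the
  Cayley-Hamilton theorem, the space of linear forms carries a flag
  \<open>{0} = G 0, \<dots>, G n\<close> with \<open>(\<phi> - lam k) (G (k + 1)) \<subseteq> G k\<close>
  (\<open>triangular_flag_exists\<close>). If every factor \<open>v i\<close> of a nonempty product \<open>v\<close> lies in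
  some \<open>G (\<kappa> i)\<close> with \<open>\<kappa> i > 0\<close>, then \<open>\<phi> v - c v\<close> is a sum of products of the same kind with
  a smaller \<open>\<Sum>i. \<kappa> i\<close>, where \<open>c \<noteq> 1\<close> is a monomial in the eigenvalues. Products with a
  factor in \<open>G 0\<close> are zero, so by induction these products lie in the image; then so does \<open>(1 - c) v\<close>, hence \<open>v\<close>
  (\<open>prod_forms_in_Im\<close>). Every nonconstant monomial is such a product, its factors being variables
  in \<open>G n\<close>.
\<close>

section \<open>Polynomials in an endomorphism of a module\<close>

locale module_endomorphism = Modules.module_hom scale scale f
  for scale :: "'a::comm_ring_1 \<Rightarrow> 'b::ab_group_add \<Rightarrow> 'b" and f :: "'b \<Rightarrow> 'b"
begin

definition poly_act :: "'a poly \<Rightarrow> 'b \<Rightarrow> 'b" where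
  "poly_act p v = (\<Sum>i\<le>degree p. scale (coeff p i) ((f ^^ i) v))"

lemma poly_act_0 [simp]: "poly_act 0 v = 0"
  by (simp add: poly_act_def)

lemma poly_act_pCons [simp]: "poly_act (pCons a p) v = scale a v + f (poly_act p v)"
proof (cases "p = 0")
  case False
  then show ?thesis
    by (simp add: poly_act_def degree_pCons_eq sum.atMost_Suc_shift sum scale
             del: sum.atMost_Suc)
qed (simp add: poly_act_def)

lemma poly_act_1 [simp]: "poly_act 1 v = v"
  by (simp add: one_pCons)

lemma poly_act_add: "poly_act (p + q) v = poly_act p v + poly_act q v"
  by (induction p q rule: poly_induct2) (simp_all add: add m1.scale_left_distrib algebra_simps)

lemma poly_act_smult: "poly_act (Polynomial.smult a p) v = scale a (poly_act p v)"
  by (induction p) (simp_all add: scale m1.scale_right_distrib)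

lemma poly_act_sum: "poly_act (\<Sum>i\<in>S. p i) v = (\<Sum>i\<in>S. poly_act (p i) v)"
  by (induction S rule: infinite_finite_induct) (simp_all add: poly_act_add)

lemma poly_act_mult: "poly_act (p * q) v = poly_act p (poly_act q v)"
  by (induction p) (simp_all add: poly_act_add poly_act_smult)

lemma module_hom_poly_act: "Modules.module_hom scale scale (poly_act p)"
proof unfold_locales
  show "poly_act p (v + w) = poly_act p v + poly_act p w" for v w
    by (induction p) (simp_all add: add m1.scale_right_distrib algebra_simps)
  show "poly_act p (scale c v) = scale c (poly_act p v)" for c v
    by (induction p) (simp_all add: scale m1.scale_right_distrib mult.commute)
qed

lemma poly_act_in_subspace:
  assumes "m1.subspace V" and "\<And>v. v \<in> V \<Longrightarrow> f v \<in> V" and "v \<in> V"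
  shows "poly_act p v \<in> V"
  using assms by (induction p) (auto simp: m1.subspace_0 intro!: m1.subspace_add m1.subspace_scale)

text \<open>
  Cayley-Hamilton for a family \<open>x\<close> on which \<open>f\<close> acts through \<open>A\<close>. In the module over the
  polynomial ring in which the variable acts as \<open>f\<close>, the hypothesis on \<open>x\<close> says that the matrix
  \<open>C\<close>, the variable times the identity minus \<open>A\<close>, kills the column \<open>x\<close>. Multiplying by the
  adjugate of \<open>C\<close> shows that \<open>det C\<close>, which is the characteristic polynomial, kills
  every entry of \<open>x\<close>.
\<close>
theorem cayley_hamilton_generators:
  assumes A: "A \<in> carrier_mat n n"
    and x: "\<And>i. i < n \<Longrightarrow> f (x i) = (\<Sum>j<n. scale (A $$ (i, j)) (x j))"
    and k: "k < n"
  shows "poly_act (char_poly A) (x k) = 0"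
proof -
  define C where "C = char_poly_matrix A"
  have C: "C \<in> carrier_mat n n" using A by (simp add: C_def)
  have C_entry: "C $$ (i, j) = (if i = j then [:0, 1:] else 0) + [:- (A $$ (i, j)):]"
    if "i < n" "j < n" for i j
    using that A by (auto simp: C_def char_poly_matrix_def)
  have C_row: "(\<Sum>j<n. poly_act (C $$ (i, j)) (x j)) = 0" if i: "i < n" for i
  proof -
    have "(\<Sum>j<n. poly_act (C $$ (i, j)) (x j))
        = (\<Sum>j<n. (if j = i then f (x j) else 0) - scale (A $$ (i, j)) (x j))"
      by (rule sum.cong) (auto simp: C_entry i poly_act_add)
    also have "\<dots> = f (x i) - (\<Sum>j<n. scale (A $$ (i, j)) (x j))"
      using i by (simp add: sum_subtractf)
    finally show ?thesis using x[OF i] by simp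
  qed
  note adj = adj_mat[OF C]
  have entry: "(\<Sum>i<n. adj_mat C $$ (k, i) * C $$ (i, j)) = (if j = k then char_poly A else 0)"
    if j: "j < n" for j
  proof -
    have "(\<Sum>i<n. adj_mat C $$ (k, i) * C $$ (i, j)) = (adj_mat C * C) $$ (k, j)"
      using k j adj(1) C by (auto simp: scalar_prod_def atLeast0LessThan intro!: sum.cong)
    also have "\<dots> = (if j = k then char_poly A else 0)"
      unfolding adj(3) using k j by (auto simp: char_poly_def C_def)
    finally show ?thesis .
  qed
  have "poly_act (char_poly A) (x k) = (\<Sum>j<n. if j = k then poly_act (char_poly A) (x j) else 0)"
    using k by simp
  also have "\<dots> = (\<Sum>j<n. poly_act (\<Sum>i<n. adj_mat C $$ (k, i) * C $$ (i, j)) (x j))"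
    by (rule sum.cong) (auto simp: entry)
  also have "\<dots> = (\<Sum>j<n. \<Sum>i<n. poly_act (adj_mat C $$ (k, i)) (poly_act (C $$ (i, j)) (x j)))"
    by (simp add: poly_act_sum poly_act_mult)
  also have "\<dots> = (\<Sum>i<n. poly_act (adj_mat C $$ (k, i)) (\<Sum>j<n. poly_act (C $$ (i, j)) (x j)))"
    by (subst sum.swap) (simp add: module_hom.sum[OF module_hom_poly_act])
  also have "\<dots> = 0"
    by (simp add: C_row module_hom.zero[OF module_hom_poly_act])
  finally show ?thesis .
qed

text \<open>
  The flag is \<open>G k = (\<Prod>j=k..<n. f - lam j) V\<close>: applying one more factor moves
  from \<open>G (k + 1)\<close> to \<open>G k\<close>, and after all factors nothing is left. Thus \<open>f\<close> is triangular
  with diagonal \<open>lam\<close>.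
\<close>
lemma triangular_flag_exists:
  assumes V: "m1.subspace V" and inv: "\<And>v. v \<in> V \<Longrightarrow> f v \<in> V"
    and annihilates: "\<And>v. v \<in> V \<Longrightarrow> poly_act (\<Prod>k<n. [:- lam k, 1:]) v = 0"
  obtains G :: "nat \<Rightarrow> 'b set"
  where "G 0 = {0}" and "G n = V" and "\<And>k. G k \<subseteq> V"
    and "\<And>k c v. v \<in> G k \<Longrightarrow> scale c v \<in> G k"
    and "\<And>k v. k < n \<Longrightarrow> v \<in> G (Suc k) \<Longrightarrow> f v - scale (lam k) v \<in> G k"
proof
  define G where "G k = poly_act (\<Prod>j=k..<n. [:- lam j, 1:]) ` V" for k
  note hom = module_hom_poly_act
  show "G 0 = {0}"
    using m1.subspace_0[OF V] annihilates by (force simp: G_def atLeast0LessThan)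
  show "G n = V"
    by (simp add: G_def)
  show "G k \<subseteq> V" for k
    using poly_act_in_subspace[OF V inv] by (auto simp: G_def)
  show "scale c v \<in> G k" if "v \<in> G k" for k c v
    using that m1.subspace_scale[OF V]
    by (auto simp: G_def module_hom.scale[OF hom, symmetric])
  show "f v - scale (lam k) v \<in> G k" if k: "k < n" and v: "v \<in> G (Suc k)" for k v
  proof -
    from v obtain u where u: "u \<in> V" and v_eq: "v = poly_act (\<Prod>j=Suc k..<n. [:- lam j, 1:]) u"
      by (auto simp: G_def)
    have "f v - scale (lam k) v = poly_act [:- lam k, 1:] v"
      by simp
    also have "\<dots> = poly_act (\<Prod>j=k..<n. [:- lam j, 1:]) u"
      using k by (simp add: v_eq poly_act_mult[symmetric] prod.atLeast_Suc_lessThan del: poly_act_pCons)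
    finally show ?thesis using u by (simp add: G_def)
  qed
qed

end


section \<open>Constants, monomials and constant coefficients\<close>

lemma mconst_simps [simp]:
  "mconst 0 = 0" "mconst 1 = 1" "mconst (a + b) = mconst a + mconst b"
  "mconst (a * b) = mconst a * mconst b"
  by (simp_all add: mconst_def single_add mult_single)

lemma module_mconst: "Modules.module (\<lambda>c p. mconst c * p)"
  by unfold_locales (simp_all add: algebra_simps)

lemma single_eq_mconst_mult: "Poly_Mapping.single m c = mconst c * Poly_Mapping.single m 1"
  by (simp add: mconst_def mult_single)

lemma mpoly_eq_sum_monomials:
  "p = (\<Sum>m\<in>Poly_Mapping.keys p. mconst (Poly_Mapping.lookup p m) * Poly_Mapping.single m 1)"
  for p :: "'k::comm_ring_1 mpoly"
  unfolding single_eq_mconst_mult[symmetric]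
  by (rule poly_mapping_eqI) (auto simp: lookup_sum lookup_single when_def in_keys_iff)

lemma single_sum_eq_prod:
  "Poly_Mapping.single (\<Sum>i\<in>S. a i) (1::'k::comm_ring_1) = (\<Prod>i\<in>S. Poly_Mapping.single (a i) 1)"
proof (induction S rule: infinite_finite_induct)
  case (insert i S)
  then show ?case by (simp add: insert.IH[symmetric] mult_single)
qed simp_all

text \<open>
  Repeated factors are told apart by a second index, so that every monomial is a product of
  variables without exponents; in this form it is covered by \<open>prod_forms_in_Im\<close> below.
\<close>
lemma monomial_eq_prod_mvar:
  fixes m :: "nat \<Rightarrow>\<^sub>0 nat"
  shows "Poly_Mapping.single m (1::'k::comm_ring_1)
    = (\<Prod>(j, e)\<in>Sigma (Poly_Mapping.keys m) (\<lambda>j. {..<Poly_Mapping.lookup m j}). mvar j)"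
proof -
  have block: "Poly_Mapping.lookup (\<Sum>e<N. Poly_Mapping.single j (1::nat)) k = (if j = k then N else 0)"
    for N j k :: nat
    by (cases "j = k") (simp_all add: lookup_sum lookup_single del: sum_constant, simp)
  have "m = (\<Sum>j\<in>Poly_Mapping.keys m. \<Sum>e<Poly_Mapping.lookup m j. Poly_Mapping.single j 1)"
    by (rule poly_mapping_eqI)
      (simp add: lookup_sum[of _ "Poly_Mapping.keys m"] block in_keys_iff del: sum_constant One_nat_def)
  also have "\<dots> = (\<Sum>(j, e)\<in>Sigma (Poly_Mapping.keys m) (\<lambda>j. {..<Poly_Mapping.lookup m j}).
      Poly_Mapping.single j 1)"
    by (simp add: sum.Sigma del: sum_constant)
  finally show ?thesis
    unfolding mvar_def split_def by (metis (no_types) single_sum_eq_prod)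
qed

lemma lookup_mconst_mult:
  "Poly_Mapping.lookup (mconst c * p) m = c * Poly_Mapping.lookup p m"
  for p :: "'k::comm_ring_1 mpoly"
  unfolding mconst_def mult_map_scale_conv_mult[symmetric] by (simp add: map.rep_eq when_def)

lemma lookup_mvar:
  "Poly_Mapping.lookup (mvar i :: 'k::comm_ring_1 mpoly) (Poly_Mapping.single j 1) = (if j = i then 1 else 0)"
proof -
  have "Poly_Mapping.single i (1::nat) = Poly_Mapping.single j 1 \<longleftrightarrow> j = i"
    by (metis lookup_single_eq lookup_single_not_eq zero_neq_one)
  then show ?thesis by (simp add: mvar_def lookup_single when_def)
qed

lemma lookup_mvar_0 [simp]: "Poly_Mapping.lookup (mvar i :: 'k::comm_ring_1 mpoly) 0 = 0"
proof -
  have "Poly_Mapping.single i (1::nat) \<noteq> 0"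
    by (metis lookup_single_eq lookup_zero zero_neq_one)
  then show ?thesis by (simp add: mvar_def lookup_single when_def)
qed

lemma lookup_mult_0:
  fixes p q :: "'k::comm_ring_1 mpoly"
  shows "Poly_Mapping.lookup (p * q) 0 = Poly_Mapping.lookup p 0 * Poly_Mapping.lookup q 0"
proof -
  have split: "0 = a + b \<longleftrightarrow> a = 0 \<and> b = 0" for a b :: "nat \<Rightarrow>\<^sub>0 nat"
    by (auto simp: poly_mapping_eq_iff fun_eq_iff lookup_add)
  have "Poly_Mapping.lookup (p * q) 0
      = Sum_any (\<lambda>a. Poly_Mapping.lookup p a *
          Sum_any (\<lambda>b. Poly_Mapping.lookup q b when (b = 0 \<and> a = 0)))"
    unfolding lookup_mult split by (simp add: conj_commute)
  also have "\<dots> = Sum_any (\<lambda>a. Poly_Mapping.lookup p a * Poly_Mapping.lookup q 0 when a = 0)"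
    by (rule Sum_any.cong) (simp add: when_when[symmetric] when_def)
  finally show ?thesis by simp
qed

lemma lookup_prod_0:
  fixes p :: "'i \<Rightarrow> 'k::comm_ring_1 mpoly"
  shows "Poly_Mapping.lookup (\<Prod>i\<in>S. p i) 0 = (\<Prod>i\<in>S. Poly_Mapping.lookup (p i) 0)"
  by (induction S rule: infinite_finite_induct) (simp_all add: lookup_mult_0 lookup_one)


section \<open>The image of an E-derivation that is linear on the variables\<close>

locale linear_mpoly_endo =
  fixes n :: nat and A :: "'k::field mat" and \<phi> :: "'k mpoly \<Rightarrow> 'k mpoly"
  assumes A: "A \<in> carrier_mat n n"
    and endo: "algebra_endo n \<phi>"
    and linear: "linear_on_vars n A \<phi>"
begin

abbreviation "P \<equiv> carrier (mpoly_ring n) :: 'k mpoly set"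

abbreviation "forms \<equiv> Modules.module.span (\<lambda>c p. mconst c * p) (mvar ` {..<n}) :: 'k mpoly set"

text \<open>
  The map \<open>\<phi>\<close> is a homomorphism only on \<open>P\<close>, whereas an endomorphism of a module has to be
  linear on a whole type. This map is linear everywhere and agrees with \<open>\<phi>\<close> on linear forms:
  it takes the linear part of a polynomial and applies \<open>\<phi>\<close> to it.
\<close>
definition linear_part :: "'k mpoly \<Rightarrow> 'k mpoly" where
  "linear_part p = (\<Sum>i<n. mconst (Poly_Mapping.lookup p (Poly_Mapping.single i 1)) * \<phi> (mvar i))"

sublocale module_endomorphism "\<lambda>c p. mconst c * p" linear_part
proof (intro module_endomorphism.intro module_hom.intro module_mconst module_hom_axioms.intro)
  show "linear_part (p + q) = linear_part p + linear_part q" for p q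
    by (simp add: linear_part_def lookup_add distrib_right sum.distrib)
  show "linear_part (mconst c * p) = mconst c * linear_part p" for c p
    by (simp add: linear_part_def lookup_mconst_mult sum_distrib_left mult.assoc)
qed

lemma \<phi>_closed: "p \<in> P \<Longrightarrow> \<phi> p \<in> P"
  using endo by (auto simp: algebra_endo_def dest: Ring.ring_hom_closed)

lemma \<phi>_add: "p \<in> P \<Longrightarrow> q \<in> P \<Longrightarrow> \<phi> (p + q) = \<phi> p + \<phi> q"
  using endo Ring.ring_hom_add[of \<phi> "mpoly_ring n" "mpoly_ring n" p q]
  by (simp add: algebra_endo_def mpoly_ring_simps(2-))

lemma \<phi>_mult: "p \<in> P \<Longrightarrow> q \<in> P \<Longrightarrow> \<phi> (p * q) = \<phi> p * \<phi> q"
  using endo Ring.ring_hom_mult[of \<phi> "mpoly_ring n" "mpoly_ring n" p q]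
  by (simp add: algebra_endo_def mpoly_ring_simps(2-))

lemma \<phi>_mconst [simp]: "\<phi> (mconst c) = mconst c"
  using endo by (simp add: algebra_endo_def)

lemma \<phi>_0 [simp]: "\<phi> 0 = 0"
  using \<phi>_mconst[of 0] by simp

lemma \<phi>_1 [simp]: "\<phi> 1 = 1"
  using \<phi>_mconst[of 1] by simp

lemma \<phi>_scale: "p \<in> P \<Longrightarrow> \<phi> (mconst c * p) = mconst c * \<phi> p"
  by (simp add: \<phi>_mult mpoly_carrier_const)

lemma \<phi>_sum: "(\<And>i. i \<in> S \<Longrightarrow> p i \<in> P) \<Longrightarrow> \<phi> (\<Sum>i\<in>S. p i) = (\<Sum>i\<in>S. \<phi> (p i))"
  by (induction S rule: infinite_finite_induct) (auto simp: \<phi>_add mpoly_carrier_sum)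

lemma \<phi>_prod: "(\<And>i. i \<in> S \<Longrightarrow> p i \<in> P) \<Longrightarrow> \<phi> (\<Prod>i\<in>S. p i) = (\<Prod>i\<in>S. \<phi> (p i))"
  by (induction S rule: infinite_finite_induct) (auto simp: \<phi>_mult mpoly_carrier_prod)

lemma \<phi>_mvar: "i < n \<Longrightarrow> \<phi> (mvar i) = (\<Sum>j<n. mconst (A $$ (i, j)) * mvar j)"
  using linear by (simp add: linear_on_vars_def)

lemma linear_part_mvar:
  assumes "i < n"
  shows "linear_part (mvar i) = \<phi> (mvar i)"
proof -
  have "linear_part (mvar i) = (\<Sum>j<n. if j = i then \<phi> (mvar j) else 0)"
    unfolding linear_part_def by (rule sum.cong) (simp_all add: lookup_mvar del: One_nat_def)
  then show ?thesis using assms by simp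
qed

lemma linear_part_in_forms: "linear_part p \<in> forms"
proof -
  have "\<phi> (mvar i) \<in> forms" if "i < n" for i
    unfolding \<phi>_mvar[OF that] by (intro m1.span_sum m1.span_scale m1.span_base) simp
  then show ?thesis
    unfolding linear_part_def by (intro m1.span_sum m1.span_scale) simp
qed

lemma \<phi>_on_forms:
  assumes "v \<in> forms"
  shows "v \<in> P" and "\<phi> v = linear_part v"
proof -
  have "v \<in> P \<and> \<phi> v = linear_part v"
    using assms
  proof (induction rule: m1.span_induct_alt)
    case base
    then show ?case by (simp add: mpoly_carrier_0)
  next
    case (step c x y)
    then show ?case
      by (auto simp: \<phi>_add \<phi>_scale add scale linear_part_mvar mpoly_carrier_add
          mpoly_carrier_mult mpoly_carrier_const mpoly_carrier_var)
  qed
  then show "v \<in> P" and "\<phi> v = linear_part v" by auto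
qed

lemma char_poly_annihilates_forms:
  assumes "v \<in> forms"
  shows "poly_act (char_poly A) v = 0"
  using assms
proof (induction rule: m1.span_induct_alt)
  case base
  then show ?case by (simp add: module_hom.zero[OF module_hom_poly_act])
next
  case (step c x y)
  then obtain i where i: "i < n" and x: "x = mvar i" by auto
  have "poly_act (char_poly A) x = 0"
    unfolding x
    by (rule cayley_hamilton_generators[OF A]) (simp_all add: i linear_part_mvar \<phi>_mvar)
  with step show ?case
    by (simp add: module_hom.add[OF module_hom_poly_act] module_hom.scale[OF module_hom_poly_act])
qed

abbreviation "Im\<delta> \<equiv> Im_E_derivation n \<phi>"

lemma subspace_Im: "m1.subspace Im\<delta>"
proof (rule m1.subspaceI)
  show "0 \<in> Im\<delta>"
    unfolding Im_E_derivation_def by (rule image_eqI[of _ _ 0]) (simp_all add: mpoly_carrier_0)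
  show "x + y \<in> Im\<delta>" if "x \<in> Im\<delta>" "y \<in> Im\<delta>" for x y
  proof -
    from that obtain p q where "p \<in> P" "x = p - \<phi> p" "q \<in> P" "y = q - \<phi> q"
      by (auto simp: Im_E_derivation_def)
    then show ?thesis unfolding Im_E_derivation_def
      by (intro image_eqI[of _ _ "p + q"]) (simp_all add: \<phi>_add mpoly_carrier_add)
  qed
  show "mconst c * x \<in> Im\<delta>" if "x \<in> Im\<delta>" for c x
  proof -
    from that obtain p where "p \<in> P" "x = p - \<phi> p"
      by (auto simp: Im_E_derivation_def)
    then show ?thesis unfolding Im_E_derivation_def
      by (intro image_eqI[of _ _ "mconst c * p"])
        (simp_all add: \<phi>_scale mpoly_carrier_mult mpoly_carrier_const right_diff_distrib)
  qed
qed

text \<open>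
  The step of the induction is the triangular form of a symmetric power: write
  \<open>\<phi> (v i) = l i * v i + w i\<close> with \<open>w i\<close> one level lower in the flag and expand the product.
  The term without any \<open>w i\<close> is \<open>c\<close> times the original product, \<open>c = (\<Prod>i\<in>S. l i)\<close>; all
  other terms have a smaller sum of levels. The induction ends when some factor lies in \<open>G 0\<close>
  and the product is zero.
\<close>
lemma prod_forms_in_Im:
  fixes G :: "nat \<Rightarrow> 'k mpoly set" and lam :: "nat \<Rightarrow> 'k"
  assumes G_0: "G 0 = {0}" and G_forms: "\<And>k. G k \<subseteq> forms"
    and G_scale: "\<And>k c v. v \<in> G k \<Longrightarrow> mconst c * v \<in> G k"
    and G_step: "\<And>k v. k < n \<Longrightarrow> v \<in> G (Suc k) \<Longrightarrow> linear_part v - mconst (lam k) * v \<in> G k"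
    and nonres: "\<And>i :: nat \<Rightarrow> nat. (\<Sum>j<n. i j) \<ge> 1 \<Longrightarrow> (\<Prod>j<n. lam j ^ i j) \<noteq> 1"
    and S: "finite S" "S \<noteq> {}"
    and v: "\<And>i. i \<in> S \<Longrightarrow> \<kappa> i \<le> n \<and> v i \<in> G (\<kappa> i)"
  shows "(\<Prod>i\<in>S. v i) \<in> Im\<delta>"
  using v
proof (induction "\<Sum>i\<in>S. \<kappa> i" arbitrary: \<kappa> v rule: less_induct)
  case less
  note I = m1.subspace_0[OF subspace_Im] m1.subspace_add[OF subspace_Im]
    m1.subspace_scale[OF subspace_Im] m1.subspace_sum[OF subspace_Im]
  show ?case
  proof (cases "\<exists>i\<in>S. \<kappa> i = 0")
    case True
    then obtain i where i: "i \<in> S" "\<kappa> i = 0" by blast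
    with less.prems[of i] G_0 have "v i = 0" by simp
    with i(1) S(1) have "(\<Prod>i\<in>S. v i) = 0" by (intro prod_zero bexI)
    then show ?thesis using I(1) by simp
  next
    case False
    define l where "l i = lam (\<kappa> i - 1)" for i
    define w where "w i = linear_part (v i) - mconst (l i) * v i" for i
    \<comment> \<open>\<open>u X\<close> is the family of factors of the term that keeps the eigenvalue part
      exactly at the indices in \<open>X\<close>; its levels are \<open>\<kappa>\<close> inside \<open>X\<close> and \<open>\<kappa> - 1\<close> outside.\<close>
    define u where "u X i = (if i \<in> X then mconst (l i) * v i else w i)" for X i
    define c where "c = (\<Prod>i\<in>S. l i)"
    have w: "w i \<in> G (\<kappa> i - 1)" if "i \<in> S" for i
      using that False less.prems[OF that] G_step[of "\<kappa> i - 1" "v i"]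
      by (auto simp: w_def l_def)
    have forms: "v i \<in> forms" if "i \<in> S" for i
      using less.prems[OF that] G_forms by blast
    have P: "(\<Prod>i\<in>S. v i) \<in> P"
      by (intro mpoly_carrier_prod \<phi>_on_forms(1) forms)
    have smaller: "(\<Prod>i\<in>S. u X i) \<in> Im\<delta>" if "X \<in> Pow S - {S}" for X
    proof (rule less.hyps[where \<kappa> = "\<lambda>i. if i \<in> X then \<kappa> i else \<kappa> i - 1"])
      from that obtain j where j: "j \<in> S" "j \<notin> X" by auto
      show "(\<Sum>i\<in>S. if i \<in> X then \<kappa> i else \<kappa> i - 1) < (\<Sum>i\<in>S. \<kappa> i)"
        by (rule sum_strict_mono_ex1[OF S(1)]) (use j False in auto)
      show "(if i \<in> X then \<kappa> i else \<kappa> i - 1) \<le> n \<and> u X i \<in> G (if i \<in> X then \<kappa> i else \<kappa> i - 1)"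
        if "i \<in> S" for i
        using less.prems[OF that] w[OF that] by (auto simp: u_def G_scale)
    qed
    have u_S: "(\<Prod>i\<in>S. u S i) = mconst c * (\<Prod>i\<in>S. v i)"
    proof -
      have "mconst c = (\<Prod>i\<in>S. mconst (l i))"
        unfolding c_def by (induction S rule: infinite_finite_induct) simp_all
      then show ?thesis by (simp add: u_def prod.distrib)
    qed
    have "\<phi> (\<Prod>i\<in>S. v i) = (\<Prod>i\<in>S. \<phi> (v i))"
      by (intro \<phi>_prod \<phi>_on_forms(1) forms)
    also have "\<dots> = (\<Prod>i\<in>S. mconst (l i) * v i + w i)"
      by (rule prod.cong) (simp_all add: w_def \<phi>_on_forms(2) forms)
    also have "\<dots> = (\<Sum>X\<in>Pow S. \<Prod>i\<in>S. u X i)"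
    proof -
      have "(\<Prod>i\<in>X. mconst (l i) * v i) * (\<Prod>i\<in>S-X. w i) = (\<Prod>i\<in>S. u X i)" if "X \<subseteq> S" for X
        using prod.subset_diff[OF that S(1), of "u X"] by (simp add: u_def mult.commute)
      then show ?thesis by (simp add: prod_add[OF S(1)])
    qed
    also have "\<dots> = mconst c * (\<Prod>i\<in>S. v i) + (\<Sum>X\<in>Pow S - {S}. \<Prod>i\<in>S. u X i)"
      using S(1) by (simp add: sum.remove[of "Pow S" S] u_S)
    finally have "mconst (1 - c) * (\<Prod>i\<in>S. v i)
        = ((\<Prod>i\<in>S. v i) - \<phi> (\<Prod>i\<in>S. v i)) + (\<Sum>X\<in>Pow S - {S}. \<Prod>i\<in>S. u X i)"
      by (simp add: algebra_simps mconst_def single_diff)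
    also have "\<dots> \<in> Im\<delta>"
      by (intro I(2,4) smaller) (use P in \<open>auto simp: Im_E_derivation_def\<close>)
    finally have "mconst (inverse (1 - c)) * (mconst (1 - c) * (\<Prod>i\<in>S. v i)) \<in> Im\<delta>"
      by (rule I(3))
    moreover have "c \<noteq> 1"
    proof -
      \<comment> \<open>Collecting equal levels turns \<open>c\<close> into a monomial in the \<open>lam j\<close> of degree
        \<open>card S\<close>, which is positive, so nonresonance applies.\<close>
      define e where "e j = card {i \<in> S. \<kappa> i - 1 = j}" for j
      have range: "(\<lambda>i. \<kappa> i - 1) ` S \<subseteq> {..<n}"
        using less.prems False by fastforce
      have "(\<Sum>j<n. e j) = card S"
        using sum.group[OF S(1) finite_lessThan range, of "\<lambda>_. 1::nat"] by (simp add: e_def)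
      moreover have "card S \<ge> 1"
        using S by (simp add: Suc_le_eq card_gt_0_iff)
      moreover have "c = (\<Prod>j<n. \<Prod>i | i \<in> S \<and> \<kappa> i - 1 = j. l i)"
        unfolding c_def by (rule prod.group[OF S(1) finite_lessThan range, symmetric])
      then have "c = (\<Prod>j<n. lam j ^ e j)"
        by (simp add: e_def l_def)
      ultimately show ?thesis using nonres[of e] by simp
    qed
    ultimately show ?thesis
      by (simp add: mult.assoc[symmetric] mconst_simps(4)[symmetric] del: mconst_simps(4))
  qed
qed

text \<open>
  Taking constant coefficients is multiplicative and gives 0 on every linear form, so it cannot
  distinguish \<open>\<phi> p\<close> from \<open>p\<close>. This bounds the image of \<open>I - \<phi>\<close> from above.
\<close>
lemma lookup_\<phi>_0:
  assumes "p \<in> P"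
  shows "Poly_Mapping.lookup (\<phi> p) 0 = Poly_Mapping.lookup p 0"
proof -
  have var: "Poly_Mapping.lookup (\<phi> (mvar j)) 0 = Poly_Mapping.lookup (mvar j :: 'k mpoly) 0"
    if "j < n" for j
    by (simp add: \<phi>_mvar[OF that] lookup_sum lookup_mult_0)
  have mon_P: "Poly_Mapping.single m 1 \<in> P" if "m \<in> Poly_Mapping.keys p" for m
    using that assms by (auto simp: mpoly_ring_simps)
  have mon: "Poly_Mapping.lookup (\<phi> (Poly_Mapping.single m 1)) 0
      = Poly_Mapping.lookup (Poly_Mapping.single m 1 :: 'k mpoly) 0"
    if "m \<in> Poly_Mapping.keys p" for m
  proof -
    have m: "Poly_Mapping.keys m \<subseteq> {..<n}" using that assms by (auto simp: mpoly_ring_simps)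
    show ?thesis
      unfolding monomial_eq_prod_mvar
      by (subst \<phi>_prod)
        (use m in \<open>auto simp: lookup_prod_0 var mpoly_carrier_var split_def subset_iff
            simp del: lookup_mvar_0 intro!: prod.cong\<close>)
  qed
  have "\<phi> p = (\<Sum>m\<in>Poly_Mapping.keys p.
      mconst (Poly_Mapping.lookup p m) * \<phi> (Poly_Mapping.single m 1))"
    by (subst mpoly_eq_sum_monomials[of p], subst \<phi>_sum)
      (auto simp: \<phi>_scale mon_P mpoly_carrier_mult mpoly_carrier_const)
  also have "Poly_Mapping.lookup \<dots> 0 = Poly_Mapping.lookup (\<Sum>m\<in>Poly_Mapping.keys p.
      mconst (Poly_Mapping.lookup p m) * Poly_Mapping.single m 1) 0"
    by (simp add: lookup_sum lookup_mult_0 mon)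
  finally show ?thesis by (simp add: mpoly_eq_sum_monomials[symmetric])
qed

theorem Im_eq_augmentation_ideal:
  fixes lam :: "nat \<Rightarrow> 'k"
  assumes eig: "eigenvalue_list n A lam"
    and nonres: "\<And>i :: nat \<Rightarrow> nat. (\<Sum>j<n. i j) \<ge> 1 \<Longrightarrow> (\<Prod>j<n. lam j ^ i j) \<noteq> 1"
  shows "Im\<delta> = {p \<in> P. Poly_Mapping.lookup p 0 = 0}"
proof
  show "Im\<delta> \<subseteq> {p \<in> P. Poly_Mapping.lookup p 0 = 0}"
  proof
    fix q assume "q \<in> Im\<delta>"
    then obtain p where p: "p \<in> P" and q: "q = p + - \<phi> p"
      by (auto simp: Im_E_derivation_def)
    have "q \<in> P"
      unfolding q by (intro mpoly_carrier_add mpoly_carrier_uminus \<phi>_closed p)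
    then show "q \<in> {p \<in> P. Poly_Mapping.lookup p 0 = 0}"
      by (simp add: q lookup_minus lookup_\<phi>_0[OF p])
  qed
  have flag: "poly_act (\<Prod>k<n. [:- lam k, 1:]) v = 0" if "v \<in> forms" for v
    using char_poly_annihilates_forms[OF that] eig by (simp add: eigenvalue_list_def)
  obtain G where G: "G 0 = {0}" "G n = forms" "\<And>k. G k \<subseteq> forms"
    "\<And>k c v. v \<in> G k \<Longrightarrow> mconst c * v \<in> G k"
    "\<And>k v. k < n \<Longrightarrow> v \<in> G (Suc k) \<Longrightarrow> linear_part v - mconst (lam k) * v \<in> G k"
    by (rule triangular_flag_exists[of forms lam n])
      (rule m1.subspace_span, rule linear_part_in_forms, erule flag, rule that)
  have monomial: "Poly_Mapping.single m 1 \<in> Im\<delta>"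
    if m: "Poly_Mapping.keys m \<subseteq> {..<n}" "m \<noteq> 0" for m
    unfolding monomial_eq_prod_mvar split_def
  proof (rule prod_forms_in_Im[OF G(1,3,4,5) nonres, where \<kappa> = "\<lambda>_. n"])
    show "Sigma (Poly_Mapping.keys m) (\<lambda>j. {..<Poly_Mapping.lookup m j}) \<noteq> {}"
      using m(2) by (force simp: in_keys_iff poly_mapping_eq_iff fun_eq_iff)
    show "n \<le> n \<and> mvar (fst i) \<in> G n"
      if "i \<in> Sigma (Poly_Mapping.keys m) (\<lambda>j. {..<Poly_Mapping.lookup m j})" for i
      using that m(1) by (auto simp: G(2) intro!: m1.span_base)
  qed auto
  show "{p \<in> P. Poly_Mapping.lookup p 0 = 0} \<subseteq> Im\<delta>"
  proof
    fix p assume p: "p \<in> {p \<in> P. Poly_Mapping.lookup p 0 = 0}"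
    have "(\<Sum>m\<in>Poly_Mapping.keys p. mconst (Poly_Mapping.lookup p m) * Poly_Mapping.single m 1) \<in> Im\<delta>"
      using p
      by (intro m1.subspace_sum[OF subspace_Im] m1.subspace_scale[OF subspace_Im] monomial)
        (auto simp: mpoly_ring_simps in_keys_iff)
    then show "p \<in> Im\<delta>"
      by (simp add: mpoly_eq_sum_monomials[symmetric])
  qed
qed

end

lemma ideal_augmentation:
  "ideal {p \<in> carrier (mpoly_ring n). Poly_Mapping.lookup p 0 = 0}
    (mpoly_ring n :: 'k::comm_ring_1 mpoly ring)"
proof (rule idealI)
  interpret cring "mpoly_ring n :: 'k mpoly ring" by (rule mpoly_ring_cring)
  show "ring (mpoly_ring n :: 'k mpoly ring)" by (rule ring_axioms)
  have minus: "\<ominus>\<^bsub>mpoly_ring n\<^esub> p = - p" if "p \<in> carrier (mpoly_ring n)" for p :: "'k mpoly"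
    by (rule minus_equality) (simp_all add: that mpoly_carrier_uminus mpoly_ring_simps(2-))
  show "subgroup {p \<in> carrier (mpoly_ring n). Poly_Mapping.lookup p 0 = 0}
    (add_monoid (mpoly_ring n :: 'k mpoly ring))"
    by (rule add.subgroupI)
      (auto simp: minus mpoly_carrier_uminus mpoly_carrier_0 mpoly_carrier_add
        lookup_add mpoly_ring_simps(2-))
qed (simp_all add: mpoly_ring_simps(2-) mpoly_carrier_mult lookup_mult_0)

theorem theorem2p1:
  fixes n :: nat
    and A :: "'k::{alg_closed_field, field_char_0} mat"
    and lam :: "nat \<Rightarrow> 'k"
    and \<phi> :: "'k mpoly \<Rightarrow> 'k mpoly"
  assumes "A \<in> carrier_mat n n"
    and "algebra_endo n \<phi>"
    and "linear_on_vars n A \<phi>"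
    and "eigenvalue_list n A lam"
  shows "((\<forall>k<n. \<forall>i :: nat \<Rightarrow> nat. (\<Sum>j = k..<n. i j) \<ge> 1 \<longrightarrow> (\<Prod>j = k..<n. lam j ^ i j) \<noteq> 1)
            \<longrightarrow> ideal (Im_E_derivation n \<phi>) (mpoly_ring n))
       \<and> (\<forall>c. (\<forall>k<n. lam k = c) \<and> \<not> root_of_unity c
            \<longrightarrow> ideal (Im_E_derivation n \<phi>) (mpoly_ring n))"
proof -
  interpret linear_mpoly_endo n A \<phi>
    by (rule linear_mpoly_endo.intro) (fact assms)+
  have nonresonant: "ideal (Im_E_derivation n \<phi>) (mpoly_ring n)"
    if "\<And>i :: nat \<Rightarrow> nat. (\<Sum>j<n. i j) \<ge> 1 \<Longrightarrow> (\<Prod>j<n. lam j ^ i j) \<noteq> 1"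
  proof -
    have "Im\<delta> = {p \<in> carrier (mpoly_ring n). Poly_Mapping.lookup p 0 = 0}"
      by (rule Im_eq_augmentation_ideal[OF assms(4)]) (rule that)
    then show ?thesis by (simp only: ideal_augmentation)
  qed
  show ?thesis
  proof (intro conjI impI allI)
    assume all_k: "\<forall>k<n. \<forall>i :: nat \<Rightarrow> nat.
      (\<Sum>j = k..<n. i j) \<ge> 1 \<longrightarrow> (\<Prod>j = k..<n. lam j ^ i j) \<noteq> 1"
    show "ideal (Im_E_derivation n \<phi>) (mpoly_ring n)"
    proof (rule nonresonant)
      fix i :: "nat \<Rightarrow> nat" assume i: "(\<Sum>j<n. i j) \<ge> 1"
      then have "0 < n" by (cases n) simp_all
      with all_k i show "(\<Prod>j<n. lam j ^ i j) \<noteq> 1"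
        unfolding lessThan_atLeast0 by blast
    qed
  next
    fix c assume c: "(\<forall>k<n. lam k = c) \<and> \<not> root_of_unity c"
    show "ideal (Im_E_derivation n \<phi>) (mpoly_ring n)"
    proof (rule nonresonant)
      fix i :: "nat \<Rightarrow> nat" assume i: "(\<Sum>j<n. i j) \<ge> 1"
      have "(\<Prod>j<n. lam j ^ i j) = c ^ (\<Sum>j<n. i j)"
        using c by (simp add: power_sum)
      with c i show "(\<Prod>j<n. lam j ^ i j) \<noteq> 1"
        unfolding root_of_unity_def by metis
    qed
  qed
qed

end
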